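(* Let $f:\mathbb{R}^n\to\mathbb{R}$ be a $\mathcal{C}^1$-smooth function, let $\bar x\in\mathbb{R}^n$, and let $\Delta>0$. Assume that $\bar x$ is a local minimizer of $f$, that $f$ satisfies the KL property at $\bar x$, and that $\nabla f$ is locally Lipschitz continuous around $\bar x$ (i.e., Lipschitz continuous on some neighborhood of $\bar x$). Let $\mathcal{G}$ be a local approximation of $\nabla f$, let $\theta\in(0,1)$, and let $\mu>2$. Then: (i) There exist positive numbers $\xi$, $T$, and $C$ such that for any initial point $x^1\in\mathbb{B}(\bar x,\xi)$, any initial radius $\delta_1\in(0,\Delta]$, and any sequences $\{\tau_k\}\subset[0,T]$, $\{C_k\}\subset[C,\infty)$, and $\{\nu_k\}\subset(0,\infty)$, the iterative sequence $\{x^k\}$ of Algorithm GDF (described in the context) converges provided that $\nabla f(x^k)\ne0$ for all $k\in\mathbb{N}$. (ii) If, in the setting of (i), in addition the series $\sum_{k=1}^\infty\tau_k$ diverges, then the sequence $\{x^k\}$ converges to a local minimizer $\tilde x$ of $f$ with $f(\tilde x)=f(\bar x)$. Moreover, the following convergence rates are guaranteed if the sequence $\{\tau_k\}$ is bounded away from $0$ and if the KL property at $\bar x$ is satisfied with $\psi(t)=Mt^q$, $M>0$, and $q\in(0,1)$: - If $q\in(0,1/2]$, the sequences $\{x^k\}$, $\{\nabla f(x^k)\}$, and $\{f(x^k)\}$ converge linearly as $k\to\infty$ to $\tilde x$, $0\in\mathbb{R}^n$, and $f(\bar x)$, respectively. - If $q\in(1/2,1)$, then $\|x^k-\tilde x\|=\mathcal{O}\big(k^{-\frac{1-q}{2q-1}}\big)$,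 $\|\nabla f(x^k)\|=\mathcal{O}\big(k^{-\frac{1-q}{2q-1}}\big)$, and $f(x^k)-f(\bar x)=\mathcal{O}\big(k^{-\frac{2-2q}{2q-1}}\big)$ as $k\to\infty$.
   Context: $\|\cdot\|$ is the Euclidean norm on $\mathbb{R}^n$, $\mathbb{N}=\{1,2,\dots\}$, and $\mathbb{B}(x,\varepsilon)$ is the open ball of center $x$ and radius $\varepsilon$. Local approximation: a mapping $\mathcal{G}:\mathbb{R}^n\times(0,\infty)\to\mathbb{R}^n$ is a local approximation of $\nabla f$ if for any bounded set $\Omega\subset\mathbb{R}^n$ and any $\Delta'>0$ there is $C'>0$ such that $\|\mathcal{G}(x,\delta)-\nabla f(x)\|\le C'\delta$ for all $(x,\delta)\in\Omega\times(0,\Delta']$. Algorithm GDF. Step 0: Choose a local approximation $\mathcal{G}$ of $\nabla f$, an initial point $x^1\in\mathbb{R}^n$, an initial sampling radius $\delta_1>0$, a sequence $\{C_k\}$ of nonnegative reals, a reduction factor $\theta\in(0,1)$, a scaling factor $\mu>2$, and a sequence of sampling radii $\{\nu_k\}\subset(0,\infty)$. Set $k:=1$. Step 1: Find $g^k$ and the smallest nonnegative integer $i_k$ such that $g^k=\mathcal{G}(x^k,\min\{\theta^{i_k}\delta_k,\nu_k\})$ and $\|g^k\|>\mu C_k\theta^{i_k}\delta_k$ (such $g^k,i_k$ exist whenever $\nabla f(x^k)\neq0$). Set $\delta_{k+1}:=\theta^{i_k}\delta_k$. Step 2: Choose a stepsize $\tau_k\ge0$ and set $x^{k+1}:=x^k-\tau_kg^k$.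 Increase $k$ by $1$ and go back to Step 1. KL property: a differentiable $f:\mathbb{R}^n\to\mathbb{R}$ satisfies the KL property at $\bar x$ if there exist $\eta>0$, a neighborhood $U$ of $\bar x$, and a nondecreasing function $\psi:(0,\eta)\to(0,\infty)$ such that $1/\psi$ is integrable over $(0,\eta)$ and $\|\nabla f(x)\|\ge\psi\big(f(x)-f(\bar x)\big)$ for all $x\in U$ with $f(\bar x)<f(x)<f(\bar x)+\eta$. "With $\psi(t)=Mt^q$" means that the assumed KL property holds with that particular $\psi$ for some $\eta$ and $U$. $\{\tau_k\}$ is bounded away from $0$ if there is $\bar\tau>0$ with $\tau_k\ge\bar\tau$ for all sufficiently large $k$. A sequence $\{z^k\}$ converges linearly to $z$ if there are $c>0$ and $\rho\in(0,1)$ with $\|z^k-z\|\le c\rho^k$ for all sufficiently large $k$. *)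

theory Defs
  imports "HOL-Analysis.Analysis" "HOL-Library.Landau_Symbols"
begin

definition gradient :: "('a::real_inner \<Rightarrow> real) \<Rightarrow> 'a \<Rightarrow> 'a" where
  "gradient f x = (THE D. GDERIV f x :> D)"

lemma gradient_eqI:
  assumes "GDERIV f x :> D"
  shows "gradient f x = D"
  unfolding gradient_def
proof (rule the_equality)
  show "GDERIV f x :> D" by fact
next
  fix E assume "GDERIV f x :> E"
  with assms have "(\<lambda>h. h \<bullet> E) = (\<lambda>h. h \<bullet> D)"
    unfolding gderiv_def by (metis has_derivative_unique)
  then have "\<forall>h. h \<bullet> E = h \<bullet> D" by metis
  then show "E = D" by (simp only: vector_eq_ldot)
qed

lemma differentiable_imp_GDERIV_gradient:
  fixes f :: "'a::euclidean_space \<Rightarrow> real"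
  assumes "f differentiable (at x)"
  shows "GDERIV f x :> gradient f x"
proof -
  from assms obtain f' where f': "(f has_derivative f') (at x)"
    by (auto simp: differentiable_def)
  then have lin: "linear f'" by (rule has_derivative_linear)
  define D where "D = adjoint f' 1"
  have "f' h = h \<bullet> D" for h
    using adjoint_works[OF lin, of h 1] by (simp add: D_def)
  then have "f' = (\<lambda>h. h \<bullet> D)" by blast
  with f' have "GDERIV f x :> D" by (simp add: gderiv_def)
  then show ?thesis using gradient_eqI by metis
qed

definition C1_smooth :: "('a::euclidean_space \<Rightarrow> real) \<Rightarrow> bool" where
  "C1_smooth f \<longleftrightarrow> (\<forall>x. f differentiable (at x)) \<and> continuous_on UNIV (gradient f)"

definition local_minimizer :: "('a::topological_space \<Rightarrow> real) \<Rightarrow> 'a \<Rightarrow> bool" where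
  "local_minimizer f x \<longleftrightarrow> (\<exists>U. open U \<and> x \<in> U \<and> (\<forall>y\<in>U. f x \<le> f y))"

definition lipschitz_around :: "('a::metric_space \<Rightarrow> 'b::metric_space) \<Rightarrow> 'a \<Rightarrow> bool" where
  "lipschitz_around F x \<longleftrightarrow> (\<exists>U L. open U \<and> x \<in> U \<and> L-lipschitz_on U F)"

text \<open>The second argument of \<open>G\<close> is a sampling radius; only its positive values matter.\<close>

definition local_approximation ::
  "('a::euclidean_space \<Rightarrow> real) \<Rightarrow> ('a \<Rightarrow> real \<Rightarrow> 'a) \<Rightarrow> bool" where
  "local_approximation f G \<longleftrightarrow>
     (\<forall>\<Omega> \<Delta>'. bounded \<Omega> \<and> \<Delta>' > 0 \<longrightarrow>
        (\<exists>C'>0. \<forall>x\<in>\<Omega>. \<forall>\<delta>\<in>{0<..\<Delta>'}. norm (G x \<delta> - gradient f x) \<le> C' * \<delta>))"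

text \<open>The Kurdyka--Lojasiewicz property with a prescribed function \<open>\<psi>\<close>, for some \<open>\<eta>\<close> and some
  neighborhood. Only the restriction of \<open>\<psi>\<close> to the interval from \<open>0\<close> to \<open>\<eta>\<close> matters. The plain
  property at a point is the existence of such a \<open>\<psi>\<close>.\<close>

definition KL_property_with ::
  "('a::euclidean_space \<Rightarrow> real) \<Rightarrow> 'a \<Rightarrow> (real \<Rightarrow> real) \<Rightarrow> bool" where
  "KL_property_with f xbar \<psi> \<longleftrightarrow>
     (\<exists>\<eta>>0. \<exists>U. open U \<and> xbar \<in> U \<and>
        (\<forall>t\<in>{0<..<\<eta>}. \<psi> t > 0) \<and> mono_on {0<..<\<eta>} \<psi> \<and>
        set_integrable lborel {0<..<\<eta>} (\<lambda>t. 1 / \<psi> t) \<and>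
        (\<forall>x\<in>U. f xbar < f x \<and> f x < f xbar + \<eta> \<longrightarrow>
           norm (gradient f x) \<ge> \<psi> (f x - f xbar)))"

text \<open>The acceptance test of the line search over the exponent \<open>i\<close>, at the point \<open>y\<close> with current
  sampling radius \<open>d\<close> and current values \<open>c\<close>, \<open>v\<close> of the sequences \<open>C\<close>, \<open>\<nu>\<close>.\<close>

definition GDF_test ::
  "('a::euclidean_space \<Rightarrow> real \<Rightarrow> 'a) \<Rightarrow> real \<Rightarrow> real \<Rightarrow> real \<Rightarrow> real \<Rightarrow> 'a \<Rightarrow> real \<Rightarrow> nat \<Rightarrow> bool" where
  "GDF_test G \<theta> \<mu> c v y d i \<longleftrightarrow> norm (G y (min (\<theta> ^ i * d) v)) > \<mu> * c * \<theta> ^ i * d"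

text \<open>An infinite run of the algorithm. All sequences are indexed by \<open>k \<ge> 1\<close>; their values at
  \<open>k = 0\<close> are irrelevant.\<close>

definition GDF_run ::
  "('a::euclidean_space \<Rightarrow> real) \<Rightarrow> ('a \<Rightarrow> real \<Rightarrow> 'a) \<Rightarrow> real \<Rightarrow> real \<Rightarrow> 'a \<Rightarrow> real \<Rightarrow>
   (nat \<Rightarrow> real) \<Rightarrow> (nat \<Rightarrow> real) \<Rightarrow> (nat \<Rightarrow> real) \<Rightarrow>
   (nat \<Rightarrow> 'a) \<Rightarrow> (nat \<Rightarrow> 'a) \<Rightarrow> (nat \<Rightarrow> nat) \<Rightarrow> (nat \<Rightarrow> real) \<Rightarrow> bool" where
  "GDF_run f G \<theta> \<mu> x\<^sub>1 \<delta>\<^sub>1 \<tau> C \<nu> x g i \<delta> \<longleftrightarrow>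
     local_approximation f G \<and> 0 < \<theta> \<and> \<theta> < 1 \<and> \<mu> > 2 \<and> \<delta>\<^sub>1 > 0 \<and>
     x 1 = x\<^sub>1 \<and> \<delta> 1 = \<delta>\<^sub>1 \<and>
     (\<forall>k\<ge>1. C k \<ge> 0 \<and> \<nu> k > 0 \<and> \<tau> k \<ge> 0 \<and>
        GDF_test G \<theta> \<mu> (C k) (\<nu> k) (x k) (\<delta> k) (i k) \<and>
        (\<forall>j. GDF_test G \<theta> \<mu> (C k) (\<nu> k) (x k) (\<delta> k) j \<longrightarrow> i k \<le> j) \<and>
        g k = G (x k) (min (\<theta> ^ i k * \<delta> k) (\<nu> k)) \<and>
        \<delta> (Suc k) = \<theta> ^ i k * \<delta> k \<and>
        x (Suc k) = x k - \<tau> k *\<^sub>R g k)"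

definition bounded_away_from_0 :: "(nat \<Rightarrow> real) \<Rightarrow> bool" where
  "bounded_away_from_0 \<tau> \<longleftrightarrow> (\<exists>b>0. eventually (\<lambda>k. \<tau> k \<ge> b) sequentially)"

definition converges_linearly_to :: "(nat \<Rightarrow> 'a::real_normed_vector) \<Rightarrow> 'a \<Rightarrow> bool" where
  "converges_linearly_to z l \<longleftrightarrow>
     (\<exists>c>0. \<exists>\<rho>\<in>{0<..<1}. eventually (\<lambda>k. norm (z k - l) \<le> c * \<rho> ^ k) sequentially)"

end

theory Submission
  imports Defs
begin

text \<open>
  Near \<open>xbar\<close> the algorithm is gradient descent with a relative error, and a Lyapunov argument with a
  desingularizing function bounds the length of its trajectory.

  The acceptance test makes the error of \<open>g k\<close> relative. If the numbers \<open>C k\<close> dominate the constant of the local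
  approximation on a ball around \<open>xbar\<close>, then \<open>\<mu> > 2\<close> gives \<open>norm (g k - \<nabla>f (x k)) \<le> norm (g k) / 2\<close>,
  whatever \<open>\<nu> k\<close> is and however often the radius was reduced (\<open>GDF_run_accuracy\<close>). For
  \<open>\<tau> k \<le> 1 / (4 * L)\<close>, with \<open>L\<close> a Lipschitz constant of the gradient, a step then decreases \<open>f\<close> by at
  least \<open>\<tau> k * (norm (g k))\<^sup>2 / 4\<close>, which up to a constant factor dominates the product of the length
  of the step and the norm of the gradient (\<open>inexact_step\<close>).

  Put \<open>\<Phi> s = \<integral>\<^sub>0\<^sup>s 1 / \<psi>\<close>. Since \<open>1 / \<psi>\<close> is nonincreasing, \<open>\<Phi> s - \<Phi> t \<ge> (s - t) / \<psi> s\<close> for \<open>t < s\<close>.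
  By the KL inequality \<open>\<psi> s\<close> is at most the norm of the gradient where the gap to \<open>f xbar\<close> is
  \<open>s\<close>, so the norm of the gradient cancels and each step is no longer than \<open>6\<close> times the
  decrease of \<open>\<Phi>\<close> (\<open>one_step\<close>). The sum telescopes. As \<open>\<Phi>\<close> tends to \<open>0\<close> at \<open>0\<close>, an orbit that starts close to
  \<open>xbar\<close> never leaves the ball (\<open>trapped\<close>), has finite length, and so converges.

  If the stepsizes have divergent sum, finite length forces the gradient to vanish at the limit,
  because otherwise the stepsizes would be summable. By KL a stationary point in the ball whose
  gap is below \<open>\<eta>\<close> has value \<open>f xbar\<close>, which is the minimum over that ball.

  For \<open>\<psi> t = M * t powr q\<close> the gap \<open>s k = f (x k) - f xbar\<close> satisfies
  \<open>s (Suc k) \<le> s k - c * s k powr (2 * q)\<close>. This gives geometric decay for \<open>q \<le> 1/2\<close>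
  (\<open>linear_decay\<close>) and decay of order \<open>k powr (- 1 / (2 * q - 1))\<close> for \<open>q > 1/2\<close>
  (\<open>sublinear_decay\<close>). The tail of the trajectory is bounded by \<open>\<Phi> (s k)\<close>, which is now a multiple of
  \<open>s k powr (1 - q)\<close>, and the gradient by \<open>L\<close> times the distance to the limit (\<open>rates\<close>).
\<close>

section \<open>Desingularizing functions\<close>

text \<open>
  The inequality is the form in which a concave \<open>\<Phi>\<close> with derivative \<open>1 / \<psi>\<close> is used; it makes sense
  without differentiability, which \<open>\<Phi>\<close> may lack because \<open>\<psi>\<close> may jump. The value \<open>t = 0\<close> is
  included, so that a step can be analysed knowing only that the gap after it is nonnegative.
\<close>

definition desingularizes :: "(real \<Rightarrow> real) \<Rightarrow> (real \<Rightarrow> real) \<Rightarrow> real \<Rightarrow> bool" where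
  "desingularizes \<Phi> \<psi> \<eta> \<longleftrightarrow>
     (\<forall>s. 0 \<le> s \<and> s < \<eta> \<longrightarrow> 0 \<le> \<Phi> s) \<and>
     (\<forall>t s. 0 \<le> t \<and> t < s \<and> s < \<eta> \<longrightarrow> (s - t) / \<psi> s \<le> \<Phi> s - \<Phi> t)"

text \<open>
  Monotonicity of \<open>\<psi>\<close> bounds the integrand \<open>1 / \<psi>\<close> of the primitive from below by its value at the
  right end point.
\<close>

lemma desingularizer_exists:
  fixes \<psi> :: "real \<Rightarrow> real"
  assumes "0 < \<eta>" and pos: "\<forall>t\<in>{0<..<\<eta>}. \<psi> t > 0" and mono: "mono_on {0<..<\<eta>} \<psi>"
    and int: "set_integrable lborel {0<..<\<eta>} (\<lambda>t. 1 / \<psi> t)"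
  obtains \<Phi> where "desingularizes \<Phi> \<psi> \<eta>" and "(\<Phi> \<longlongrightarrow> 0) (at_right 0)" and "\<Phi> 0 = 0"
proof -
  define h where "h = (\<lambda>t. indicat_real {0<..<\<eta>} t *\<^sub>R (1 / \<psi> t))"
  define \<Phi> where "\<Phi> = (\<lambda>s. integral {0..s} h)"
  have "integrable lborel h"
    using int by (simp add: set_integrable_def h_def)
  then have hU: "h integrable_on UNIV"
    using has_integral_integral_lborel by blast
  have hi: "h integrable_on {a..b}" for a b
    using integrable_on_subinterval[OF hU] by blast
  have h0: "0 \<le> h t" for t
    using pos by (auto simp: h_def indicator_def less_imp_le)
  have diff: "(s - t) / \<psi> s \<le> \<Phi> s - \<Phi> t" if "0 \<le> t" "t < s" "s < \<eta>" for t s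
  proof -
    have split: "\<Phi> t + integral {t..s} h = \<Phi> s"
      unfolding \<Phi>_def by (rule Henstock_Kurzweil_Integration.integral_combine) (use that hi in auto)
    \<comment> \<open>The integrand is \<open>0\<close> at \<open>0\<close>, which lies in the interval if \<open>t = 0\<close>; the constant has to be
      lowered at this point for a pointwise comparison.\<close>
    have const: "((\<lambda>u. if u = 0 then 0 else 1 / \<psi> s) has_integral (s - t) * (1 / \<psi> s)) {t..s}"
    proof (rule has_integral_spike_finite[of "{0}"])
      show "((\<lambda>_. 1 / \<psi> s) has_integral (s - t) * (1 / \<psi> s)) {t..s}"
        using that has_integral_const_real[of "1 / \<psi> s" t s] by simp
    qed auto
    have le: "(if u = 0 then 0 else 1 / \<psi> s) \<le> h u" if u: "u \<in> {t..s}" for u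
    proof (cases "u = 0")
      case False
      then have "\<psi> u \<le> \<psi> s" "0 < \<psi> u"
        using \<open>0 \<le> t\<close> \<open>s < \<eta>\<close> u pos by (auto intro!: mono_onD[OF mono])
      then show ?thesis
        using False u \<open>0 \<le> t\<close> \<open>s < \<eta>\<close> by (auto simp: h_def frac_le)
    qed (use h0 in auto)
    have "(s - t) * (1 / \<psi> s) \<le> integral {t..s} h"
      by (rule has_integral_le[OF const integrable_integral[OF hi] le])
    with split show ?thesis by simp
  qed
  have "continuous_on {0..\<eta>} \<Phi>"
    unfolding \<Phi>_def by (rule indefinite_integral_continuous_1[OF hi])
  then have "(\<Phi> \<longlongrightarrow> \<Phi> 0) (at_right 0)"
    using \<open>0 < \<eta>\<close> by (auto simp: continuous_on_Icc_at_rightD)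
  moreover have "\<Phi> 0 = 0" by (simp add: \<Phi>_def)
  moreover have "0 \<le> \<Phi> s" for s
    unfolding \<Phi>_def by (rule integral_nonneg[OF hi]) (use h0 in auto)
  ultimately show ?thesis
    using diff by (intro that[of \<Phi>]) (auto simp: desingularizes_def)
qed

lemma desingularizes_powr:
  fixes M q \<eta> :: real
  assumes "0 < M" "0 < q" "q < 1" and \<psi>: "\<forall>t>0. \<psi> t = M * t powr q"
  shows "desingularizes (\<lambda>s. s powr (1 - q) / (M * (1 - q))) \<psi> \<eta>"
  unfolding desingularizes_def
proof (intro conjI allI impI)
  fix t s :: real assume ts: "0 \<le> t \<and> t < s \<and> s < \<eta>"
  \<comment> \<open>Weighted arithmetic and geometric means of \<open>t\<close> and \<open>s\<close>, with weights \<open>1 - q\<close> and \<open>q\<close>.\<close>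
  have "t powr (1 - q) * s powr q \<le> (1 - q) * t + q * s"
    using Youngs_inequality_0[of "1-q" q t s] assms ts by (cases "t = 0") auto
  moreover have "s powr q * s powr (1 - q) = s" using ts by (simp flip: powr_add)
  ultimately have "(1 - q) * (s - t) \<le> s powr q * (s powr (1 - q) - t powr (1 - q))"
    by (simp add: algebra_simps)
  then show "(s - t) / \<psi> s \<le> s powr (1 - q) / (M * (1 - q)) - t powr (1 - q) / (M * (1 - q))"
    using assms ts by (simp add: \<psi> divide_simps) (simp add: algebra_simps)
qed (use assms in auto)

section \<open>Decay of sequences under a power recursion\<close>

text \<open>Once \<open>s k \<le> 1\<close>, the exponent \<open>2 * q \<le> 1\<close> makes the decrement at least \<open>c * s k\<close>.\<close>

lemma linear_decay:
  fixes s :: "nat \<Rightarrow> real"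
  assumes c: "0 < c" and q: "q \<le> 1 / 2"
    and pos: "\<forall>\<^sub>F k in sequentially. 0 < s k" and lim: "s \<longlonglongrightarrow> 0"
    and rec: "\<forall>\<^sub>F k in sequentially. s (Suc k) \<le> s k - c * s k powr (2 * q)"
  obtains A \<rho> where "0 < A" "0 < \<rho>" "\<rho> < 1" "\<forall>\<^sub>F k in sequentially. s k \<le> A * \<rho> ^ k"
proof -
  \<comment> \<open>The maximum with \<open>1/2\<close> keeps the rate positive when \<open>c \<ge> 1\<close>.\<close>
  define \<rho> where "\<rho> = max (1 - c) (1 / 2)"
  have \<rho>: "0 < \<rho>" "\<rho> < 1" "1 - c \<le> \<rho>" using c by (auto simp: \<rho>_def)
  have "\<forall>\<^sub>F k in sequentially. s k < 1" using order_tendstoD(2)[OF lim] by simp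
  with pos rec have "\<forall>\<^sub>F k in sequentially. 0 < s k \<and> s (Suc k) \<le> \<rho> * s k"
  proof eventually_elim
    case (elim k)
    have "c * s k \<le> c * s k powr (2 * q)"
      using powr_mono'[of "2 * q" 1 "s k"] elim q c by simp
    moreover have "(1 - c) * s k \<le> \<rho> * s k"
      using \<rho> elim by (intro mult_right_mono) auto
    ultimately show ?case using elim by (simp add: algebra_simps)
  qed
  then obtain K where K: "\<And>k. K \<le> k \<Longrightarrow> 0 < s k \<and> s (Suc k) \<le> \<rho> * s k"
    by (auto simp: eventually_sequentially)
  have "s k \<le> s K / \<rho> ^ K * \<rho> ^ k" if "K \<le> k" for k
    using that
  proof (induction k rule: dec_induct)
    case (step k)
    have "s (Suc k) \<le> \<rho> * s k" using K step(1) by blast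
    also have "\<dots> \<le> \<rho> * (s K / \<rho> ^ K * \<rho> ^ k)" using step.IH \<rho> by (intro mult_left_mono) auto
    finally show ?case by (simp add: mult_ac)
  qed (use \<rho> in simp)
  then have "\<forall>\<^sub>F k in sequentially. s k \<le> s K / \<rho> ^ K * \<rho> ^ k"
    by (auto simp: eventually_sequentially)
  moreover have "0 < s K / \<rho> ^ K" using K \<rho> by simp
  ultimately show ?thesis using that \<rho> by blast
qed

text \<open>The convex function \<open>\<lambda>u. u powr (-a)\<close> lies above its tangent at \<open>s\<close>.\<close>

lemma powr_neg_ge_tangent:
  fixes u :: real
  assumes "0 < s" "0 < u" "0 < a"
  shows "s powr (-a) + a * s powr (-a - 1) * (s - u) \<le> u powr (-a)"
proof -
  have "ln (u / s) \<le> u / s - 1" using assms by (intro ln_le_minus_one) simp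
  then have "1 - a * (u / s - 1) \<le> 1 + (- a) * ln (u / s)" using assms by simp
  also have "\<dots> \<le> exp ((- a) * ln (u / s))" by (rule exp_ge_add_one_self)
  also have "\<dots> = (u / s) powr (- a)" using assms by (simp add: powr_def)
  finally have "s powr (- a) * (1 - a * (u / s - 1)) \<le> s powr (- a) * (u / s) powr (- a)"
    by (intro mult_left_mono) auto
  also have "\<dots> = u powr (- a)" using assms by (simp flip: powr_mult)
  finally show ?thesis
    using assms by (simp add: powr_diff field_simps)
qed

text \<open>
  With \<open>p = 2 * q - 1\<close>, the transformed sequence \<open>s k powr (-p)\<close> grows at least linearly: by the tangent
  inequality each step adds \<open>p * s k powr (-p - 1) * c * s k powr (2 * q) = p * c\<close>.
\<close>

lemma sublinear_decay:
  fixes s :: "nat \<Rightarrow> real"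
  assumes c: "0 < c" and q: "q > 1 / 2"
    and pos: "\<forall>\<^sub>F k in sequentially. 0 < s k"
    and rec: "\<forall>\<^sub>F k in sequentially. s (Suc k) \<le> s k - c * s k powr (2 * q)"
  obtains A where "0 < A" "\<forall>\<^sub>F k in sequentially. s k \<le> A * real k powr (- (1 / (2 * q - 1)))"
proof -
  define p where "p = 2 * q - 1"
  have p: "0 < p" using q by (simp add: p_def)
  obtain K where K: "\<And>k. K \<le> k \<Longrightarrow> 0 < s k"
      "\<And>k. K \<le> k \<Longrightarrow> s (Suc k) \<le> s k - c * s k powr (2 * q)"
    using eventually_conj[OF pos rec] by (auto simp: eventually_sequentially)
  have "p * c * (real k - real K) \<le> s k powr (- p)" if "K \<le> k" for k
    using that
  proof (induction k rule: dec_induct)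
    case (step k)
    have "s k powr (- p - 1) * s k powr (2 * q) = 1"
      using K(1)[OF step(1)] by (simp add: p_def flip: powr_add)
    then have "p * c = p * s k powr (- p - 1) * (c * s k powr (2 * q))" by simp
    also have "\<dots> \<le> p * s k powr (- p - 1) * (s k - s (Suc k))"
      using K(2)[OF step(1)] p by (intro mult_left_mono) auto
    finally have "p * c + s k powr (- p) \<le> s (Suc k) powr (- p)"
      using powr_neg_ge_tangent[of "s k" "s (Suc k)" p] K(1)[of k] K(1)[of "Suc k"] step(1) p by linarith
    then show ?case using step.IH by (simp add: algebra_simps)
  qed simp
  then have key: "p * c / 2 * real k \<le> s k powr (- p)" if "2 * K + 1 \<le> k" for k
  proof -
    have "p * c * (real k / 2) \<le> p * c * (real k - real K)"
      using that p c by (intro mult_left_mono) auto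
    then show ?thesis using \<open>K \<le> k \<Longrightarrow> p * c * (real k - real K) \<le> s k powr (- p)\<close> that by simp
  qed
  have "s k \<le> (p * c / 2) powr (- (1 / p)) * real k powr (- (1 / p))" if k: "2 * K + 1 \<le> k" for k
  proof -
    have "s k = (s k powr (- p)) powr (- (1 / p))"
      using K(1)[of k] k p by (simp add: powr_powr)
    also have "\<dots> \<le> (p * c / 2 * real k) powr (- (1 / p))"
      using key[OF k] k p c by (intro powr_mono2') auto
    also have "\<dots> = (p * c / 2) powr (- (1 / p)) * real k powr (- (1 / p))"
      by (rule powr_mult)
    finally show ?thesis .
  qed
  then have "\<forall>\<^sub>F k in sequentially. s k \<le> (p * c / 2) powr (- (1 / p)) * real k powr (- (1 / p))"
    by (auto simp: eventually_sequentially)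
  moreover have "0 < (p * c / 2) powr (- (1 / p))" using p c by simp
  ultimately show ?thesis using that unfolding p_def by blast
qed

text \<open>
  The next two lemmas carry a rate of the gap over to quantities that are bounded by a power of it.
\<close>

lemma converges_linearly_powr_bound:
  fixes s :: "nat \<Rightarrow> real"
  assumes A: "0 < A" and \<rho>: "0 < \<rho>" "\<rho> < 1" and le: "\<forall>\<^sub>F k in sequentially. s k \<le> A * \<rho> ^ k"
    and pos: "\<forall>\<^sub>F k in sequentially. 0 < s k" and B: "0 < B" and a: "0 < a"
    and z: "\<forall>\<^sub>F k in sequentially. norm (z k - l) \<le> B * s k powr a"
  shows "converges_linearly_to z l"
proof -
  have "\<forall>\<^sub>F k in sequentially. norm (z k - l) \<le> (B * A powr a) * (\<rho> powr a) ^ k"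
    using le pos z
  proof eventually_elim
    case (elim k)
    have "s k powr a \<le> (A * \<rho> ^ k) powr a" using elim a by (intro powr_mono2) auto
    also have "\<dots> = A powr a * (\<rho> powr a) ^ k"
      using A \<rho> by (simp add: powr_mult powr_powr mult.commute flip: powr_realpow)
    finally have "B * s k powr a \<le> B * (A powr a * (\<rho> powr a) ^ k)" using B by simp
    then show ?case using elim by simp
  qed
  moreover have "\<rho> powr a < 1" using \<rho> a powr_less_mono2[of a \<rho> 1] by simp
  ultimately show ?thesis
    unfolding converges_linearly_to_def using A B \<rho>
    by (intro exI[of _ "B * A powr a"] bexI[of _ "\<rho> powr a"]) auto
qed

lemma bigo_powr_bound:
  fixes s z :: "nat \<Rightarrow> real"
  assumes A: "0 < A" and le: "\<forall>\<^sub>F k in sequentially. s k \<le> A * real k powr (- e)"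
    and pos: "\<forall>\<^sub>F k in sequentially. 0 < s k" and B: "0 < B" and a: "0 < a"
    and z: "\<forall>\<^sub>F k in sequentially. norm (z k) \<le> B * s k powr a"
  shows "z \<in> O(\<lambda>k. real k powr (- (e * a)))"
proof (rule bigoI[of _ "B * A powr a"])
  show "\<forall>\<^sub>F k in sequentially. norm (z k) \<le> B * A powr a * norm (real k powr (- (e * a)))"
    using le pos z
  proof eventually_elim
    case (elim k)
    have "s k powr a \<le> (A * real k powr (- e)) powr a" using elim a by (intro powr_mono2) auto
    also have "\<dots> = A powr a * real k powr (- (e * a))"
      using A by (simp add: powr_mult powr_powr)
    finally have "B * s k powr a \<le> B * (A powr a * real k powr (- (e * a)))" using B by simp
    then show ?case using elim by simp
  qed
qed

section \<open>One inexact gradient step near the minimizer\<close>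

text \<open>
  All local hypotheses are imposed on one common ball. Iterates are kept in the ball of radius
  \<open>r / 2\<close>: a single step at most doubles the distance to \<open>xbar\<close>, so that the next iterate is known
  to lie in the ball before anything else is known about it.
\<close>

locale KL_basin =
  fixes f :: "'a::euclidean_space \<Rightarrow> real" and xbar :: 'a and r L \<eta> :: real and \<psi> :: "real \<Rightarrow> real"
  assumes differentiable: "\<And>y. f differentiable (at y)"
    and r_pos: "0 < r" and L_pos: "0 < L"
    and lipschitz: "L-lipschitz_on (ball xbar r) (gradient f)"
    and minimal: "\<And>y. y \<in> ball xbar r \<Longrightarrow> f xbar \<le> f y"
    and \<psi>_pos: "\<And>t. 0 < t \<Longrightarrow> t < \<eta> \<Longrightarrow> 0 < \<psi> t"
    and KL: "\<And>y. y \<in> ball xbar r \<Longrightarrow> f xbar < f y \<Longrightarrow> f y < f xbar + \<eta> \<Longrightarrow>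
               \<psi> (f y - f xbar) \<le> norm (gradient f y)"
begin

lemma has_gradient: "(f has_derivative (\<lambda>h. h \<bullet> gradient f y)) (at y)"
  using differentiable_imp_GDERIV_gradient[OF differentiable] by (simp add: gderiv_def)

lemma gradient_zero_at_minimum:
  assumes "y \<in> ball xbar r" "f y = f xbar"
  shows "gradient f y = 0"
proof -
  have "(\<lambda>h. h \<bullet> gradient f y) = (\<lambda>h. 0)"
    using assms minimal by (intro differential_zero_maxmin[OF _ open_ball has_gradient]) auto
  then show ?thesis by (metis inner_eq_zero_iff)
qed

lemma gradient_diff_le:
  "y \<in> ball xbar r \<Longrightarrow> z \<in> ball xbar r \<Longrightarrow> norm (gradient f y - gradient f z) \<le> L * norm (y - z)"
  using lipschitz_onD[OF lipschitz] by (simp add: dist_norm)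

text \<open>
  A single application of the mean value theorem costs a factor \<open>2\<close> in the quadratic term compared
  with integration along the segment, which only affects the bound on the stepsizes.
\<close>

lemma descent_lemma:
  assumes y: "y \<in> ball xbar r" and z: "z \<in> ball xbar r"
  shows "f z \<le> f y + gradient f y \<bullet> (z - y) + L * (norm (z - y))\<^sup>2"
proof -
  let ?p = "\<lambda>t. y + t *\<^sub>R (z - y)"
  have "((\<lambda>t. f (?p t)) has_derivative (\<lambda>t. (t *\<^sub>R (z - y)) \<bullet> gradient f (?p u))) (at u within {0..1})"
    for u by (rule has_derivative_compose[OF _ has_gradient]) (auto intro!: derivative_eq_intros)
  then obtain u where u: "u \<in> {0<..<1::real}"
    and mvt: "f (?p 1) - f (?p 0) = ((1 - 0) *\<^sub>R (z - y)) \<bullet> gradient f (?p u)"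
    using mvt_simple[of 0 1 "\<lambda>t. f (?p t)" "\<lambda>u t. (t *\<^sub>R (z - y)) \<bullet> gradient f (?p u)"] by auto
  have "?p u = (1 - u) *\<^sub>R y + u *\<^sub>R z" by (simp add: algebra_simps)
  then have "?p u \<in> ball xbar r"
    using convexD_alt[OF convex_ball y z, of u] u by auto
  then have "norm (gradient f (?p u) - gradient f y) \<le> L * norm (u *\<^sub>R (z - y))"
    using gradient_diff_le[OF _ y] by fastforce
  also have "\<dots> \<le> L * norm (z - y)"
    using u L_pos by (simp add: mult_left_le_one_le)
  finally have "(gradient f (?p u) - gradient f y) \<bullet> (z - y) \<le> L * norm (z - y) * norm (z - y)"
    by (meson norm_cauchy_schwarz mult_right_mono norm_ge_zero order_trans)
  with mvt show ?thesis
    by (simp add: inner_diff inner_commute power2_eq_square mult.assoc)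
qed

text \<open>
  Half-relative accuracy gives \<open>norm g \<le> 2 * norm (\<nabla>f x)\<close>, hence a short step, because the gradient
  vanishes at \<open>xbar\<close> and is Lipschitz. It also gives \<open>\<nabla>f x \<bullet> g \<ge> (norm g)\<^sup>2 / 2\<close>; half of this pays
  for the quadratic term of the descent lemma.
\<close>

lemma inexact_step:
  assumes x: "x \<in> ball xbar (r / 2)" and acc: "norm (g - gradient f x) \<le> norm g / 2"
    and \<tau>: "0 \<le> \<tau>" "\<tau> \<le> 1 / (4 * L)"
  shows "x - \<tau> *\<^sub>R g \<in> ball xbar r"
    and "f (x - \<tau> *\<^sub>R g) \<le> f x - \<tau> * (norm g)\<^sup>2 / 4"
proof -
  have xr: "x \<in> ball xbar r" using x r_pos by auto
  have \<tau>L: "\<tau> * L \<le> 1 / 4" using \<tau> L_pos by (simp add: field_simps)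
  have "norm g \<le> norm (g - gradient f x) + norm (gradient f x)"
    using norm_triangle_sub[of g "gradient f x"] by simp
  then have "norm g \<le> 2 * norm (gradient f x)" using acc by simp
  also have "\<dots> \<le> 2 * (L * norm (x - xbar))"
    using gradient_diff_le[OF xr, of xbar] gradient_zero_at_minimum[of xbar] r_pos by simp
  finally have "\<tau> * norm g \<le> \<tau> * L * (2 * norm (x - xbar))"
    using mult_left_mono[of "norm g" "2 * (L * norm (x - xbar))" \<tau>] \<tau> by (simp add: mult_ac)
  also have "\<dots> \<le> 1 / 4 * (2 * norm (x - xbar))"
    by (rule mult_right_mono[OF \<tau>L]) simp
  finally have move: "\<tau> * norm g \<le> norm (x - xbar)"
    using norm_ge_zero[of "x - xbar"] by linarith
  have "dist xbar (x - \<tau> *\<^sub>R g) \<le> norm (x - xbar) + \<tau> * norm g"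
    using norm_triangle_ineq4[of "x - xbar" "\<tau> *\<^sub>R g"] \<tau>
    by (simp add: dist_norm norm_minus_commute algebra_simps)
  then show yr: "x - \<tau> *\<^sub>R g \<in> ball xbar r"
    using move x by (simp add: dist_norm norm_minus_commute)
  have "(g - gradient f x) \<bullet> g \<le> norm g / 2 * norm g"
    by (meson acc norm_cauchy_schwarz mult_right_mono norm_ge_zero order_trans)
  then have "(norm g)\<^sup>2 / 2 \<le> gradient f x \<bullet> g"
    by (simp add: inner_diff_left power2_norm_eq_inner flip: power2_eq_square)
  then have "\<tau> * (norm g)\<^sup>2 / 2 \<le> \<tau> * (gradient f x \<bullet> g)"
    using mult_left_mono[OF _ \<tau>(1)] by fastforce
  moreover have "L * (\<tau> * norm g)\<^sup>2 \<le> \<tau> * (norm g)\<^sup>2 / 4"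
    using mult_right_mono[OF \<tau>L, of "\<tau> * (norm g)\<^sup>2"] \<tau>
    by (simp add: power2_eq_square mult_ac)
  ultimately show "f (x - \<tau> *\<^sub>R g) \<le> f x - \<tau> * (norm g)\<^sup>2 / 4"
    using descent_lemma[OF xr yr] \<tau> by simp
qed

end

section \<open>Trajectories of inexact gradient descent\<close>

text \<open>
  Accuracy is required only at iterates in the ball of radius \<open>r / 2\<close>, since the approximation
  constant is a local one; that all iterates lie there is derived below.
\<close>

locale inexact_descent = KL_basin +
  fixes \<Phi> :: "real \<Rightarrow> real" and x g :: "nat \<Rightarrow> 'a::euclidean_space" and \<tau> :: "nat \<Rightarrow> real"
  assumes update: "\<And>k. 1 \<le> k \<Longrightarrow> x (Suc k) = x k - \<tau> k *\<^sub>R g k"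
    and stepsize: "\<And>k. 1 \<le> k \<Longrightarrow> 0 \<le> \<tau> k" "\<And>k. 1 \<le> k \<Longrightarrow> \<tau> k \<le> 1 / (4 * L)"
    and accuracy: "\<And>k. 1 \<le> k \<Longrightarrow> x k \<in> ball xbar (r / 2) \<Longrightarrow>
                     norm (g k - gradient f (x k)) \<le> norm (g k) / 2"
    and nonstationary: "\<And>k. 1 \<le> k \<Longrightarrow> gradient f (x k) \<noteq> 0"
    and desing: "desingularizes \<Phi> \<psi> \<eta>"
    and start_inside: "x 1 \<in> ball xbar (r / 2)"
    and start: "dist xbar (x 1) + 6 * \<Phi> (f (x 1) - f xbar) < r / 2"
    and start_level: "f (x 1) < f xbar + \<eta>"
begin

abbreviation gap :: "nat \<Rightarrow> real" where
  "gap k \<equiv> f (x k) - f xbar"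

lemma gap_pos_in_ball: "1 \<le> k \<Longrightarrow> x k \<in> ball xbar r \<Longrightarrow> 0 < gap k"
  using minimal[of "x k"] gradient_zero_at_minimum[of "x k"] nonstationary[of k] by fastforce

text \<open>
  The last bound is the heart of the argument. The decrease of \<open>f\<close> is at least
  \<open>dist (x k) (x (Suc k)) * norm (\<nabla>f (x k)) / 6\<close>; dividing by \<open>\<psi> (gap k) \<le> norm (\<nabla>f (x k))\<close>
  turns it into a decrease of the desingularizing function. It is stated for every desingularizing
  function, because the trapping uses the primitive of \<open>1 / \<psi>\<close> and the rates use an explicit power.
\<close>

lemma one_step:
  assumes k: "1 \<le> k" and xk: "x k \<in> ball xbar (r / 2)" and lev: "gap k < \<eta>"
  shows "x (Suc k) \<in> ball xbar r"
    and "gap (Suc k) \<le> gap k - \<tau> k * (norm (gradient f (x k)))\<^sup>2 / 9"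
    and "\<tau> k * norm (gradient f (x k)) \<le> 3 / 2 * dist (x k) (x (Suc k))"
    and "desingularizes \<Phi>' \<psi> \<eta> \<Longrightarrow>
           dist (x k) (x (Suc k)) \<le> 6 * (\<Phi>' (gap k) - \<Phi>' (gap (Suc k)))"
proof -
  note acc = accuracy[OF k xk] and \<tau> = stepsize(1)[OF k]
  note step = inexact_step[OF xk acc stepsize[OF k], folded update[OF k]]
  show x': "x (Suc k) \<in> ball xbar r" by (rule step(1))
  have gr: "norm (gradient f (x k)) \<le> 3 / 2 * norm (g k)"
    using norm_triangle_sub[of "gradient f (x k)" "g k"] acc by (simp add: norm_minus_commute)
  have "(norm (gradient f (x k)))\<^sup>2 \<le> (3 / 2 * norm (g k))\<^sup>2"
    using gr by (rule power_mono) simp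
  then have "\<tau> k * (norm (gradient f (x k)))\<^sup>2 \<le> \<tau> k * (9 / 4 * (norm (g k))\<^sup>2)"
    using \<tau> by (intro mult_left_mono) (simp_all add: power_mult_distrib power2_eq_square)
  then show "gap (Suc k) \<le> gap k - \<tau> k * (norm (gradient f (x k)))\<^sup>2 / 9"
    using step(2) by simp
  have d: "dist (x k) (x (Suc k)) = \<tau> k * norm (g k)"
    using \<tau> by (simp add: update[OF k] dist_norm)
  show "\<tau> k * norm (gradient f (x k)) \<le> 3 / 2 * dist (x k) (x (Suc k))"
    using mult_left_mono[OF gr \<tau>] by (simp add: d)
  assume \<Phi>': "desingularizes \<Phi>' \<psi> \<eta>"
  have xr: "x k \<in> ball xbar r" using xk r_pos by auto
  have gp: "0 < gap k" using gap_pos_in_ball[OF k xr] .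
  have p: "0 < \<psi> (gap k)" using \<psi>_pos gp lev by blast
  have "\<psi> (gap k) \<le> norm (gradient f (x k))" using KL[OF xr] gp lev by simp
  with gr have "\<psi> (gap k) \<le> 3 / 2 * norm (g k)" by simp
  from mult_left_mono[OF this, of "\<tau> k * norm (g k)"]
  have "dist (x k) (x (Suc k)) * \<psi> (gap k) \<le> 6 * (\<tau> k * (norm (g k))\<^sup>2 / 4)"
    using \<tau> by (simp add: d power2_eq_square mult_ac)
  also have "\<dots> \<le> 6 * (gap k - gap (Suc k))" using step(2) by simp
  finally have D: "dist (x k) (x (Suc k)) \<le> 6 * ((gap k - gap (Suc k)) / \<psi> (gap k))"
    using p by (simp add: pos_le_divide_eq)
  have "(gap k - gap (Suc k)) / \<psi> (gap k) \<le> \<Phi>' (gap k) - \<Phi>' (gap (Suc k))"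
  proof (cases "gap (Suc k) = gap k")
    case False
    have "\<tau> k * (norm (g k))\<^sup>2 \<ge> 0" using \<tau> by simp
    then have "gap (Suc k) < gap k" using step(2) False by linarith
    then show ?thesis
      using \<Phi>'[unfolded desingularizes_def, THEN conjunct2, rule_format, of "gap (Suc k)" "gap k"]
        minimal[OF x'] lev by simp
  qed simp
  with D show "dist (x k) (x (Suc k)) \<le> 6 * (\<Phi>' (gap k) - \<Phi>' (gap (Suc k)))"
    by (meson mult_left_mono order_trans zero_le_numeral)
qed

text \<open>
  The distance travelled so far is part of the induction: by telescoping it never exceeds
  \<open>6 * \<Phi> (gap 1)\<close>, which together with the initial distance to \<open>xbar\<close> is below \<open>r / 2\<close>.
\<close>

lemma trapped:
  assumes "1 \<le> k"
  shows "x k \<in> ball xbar (r / 2) \<and> gap k \<le> gap 1 \<and>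
         dist (x 1) (x k) \<le> 6 * (\<Phi> (gap 1) - \<Phi> (gap k))"
  using assms
proof (induction k rule: dec_induct)
  case base
  have "0 \<le> \<Phi> (gap 1)"
    using desing minimal[of "x 1"] start_inside start_level r_pos by (simp add: desingularizes_def)
  then show ?case using start_inside by simp
next
  case (step k)
  then have k: "1 \<le> k" and xk: "x k \<in> ball xbar (r / 2)" and lev: "gap k < \<eta>"
    using start_level by auto
  note s = one_step[OF k xk lev]
  have "0 \<le> \<tau> k * (norm (gradient f (x k)))\<^sup>2" using stepsize(1)[OF k] by simp
  then have lev': "gap (Suc k) \<le> gap 1" using s(2) step by linarith
  have d: "dist (x 1) (x (Suc k)) \<le> 6 * (\<Phi> (gap 1) - \<Phi> (gap (Suc k)))"
    using s(4)[OF desing] step dist_triangle[of "x 1" "x (Suc k)" "x k"] by simp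
  moreover have "0 \<le> \<Phi> (gap (Suc k))"
    using desing minimal[OF s(1)] lev' start_level by (simp add: desingularizes_def)
  ultimately have "dist xbar (x (Suc k)) < r / 2"
    using start dist_triangle[of xbar "x (Suc k)" "x 1"] by simp
  then show ?case using lev' d by simp
qed

lemma inside: "1 \<le> k \<Longrightarrow> x k \<in> ball xbar (r / 2)"
  and inside_ball: "1 \<le> k \<Longrightarrow> x k \<in> ball xbar r"
  and level: "1 \<le> k \<Longrightarrow> gap k < \<eta>"
  using trapped[of k] start_level r_pos by auto

lemma gap_positive: "1 \<le> k \<Longrightarrow> 0 < gap k"
  using gap_pos_in_ball inside_ball by blast

lemma path_length_le:
  assumes \<Phi>': "desingularizes \<Phi>' \<psi> \<eta>" and "1 \<le> m" "m \<le> n"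
  shows "(\<Sum>k=m..<n. dist (x k) (x (Suc k))) \<le> 6 * \<Phi>' (gap m)"
proof -
  have "(\<Sum>k=m..<n. dist (x k) (x (Suc k))) \<le> (\<Sum>k=m..<n. 6 * (\<Phi>' (gap k) - \<Phi>' (gap (Suc k))))"
    using assms by (intro sum_mono one_step(4) inside level) auto
  also have "\<dots> = 6 * (\<Phi>' (gap m) - \<Phi>' (gap n))"
    using sum_Suc_diff'[OF \<open>m \<le> n\<close>, of "\<lambda>k. - 6 * \<Phi>' (gap k)"] by (simp add: algebra_simps)
  also have "\<dots> \<le> 6 * \<Phi>' (gap m)"
    using \<Phi>' gap_positive[of n] level[of n] assms by (simp add: desingularizes_def)
  finally show ?thesis .
qed

lemma finite_length: "summable (\<lambda>k. dist (x (Suc k)) (x (Suc (Suc k))))"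
proof (rule summableI_nonneg_bounded)
  fix n
  have "(\<Sum>k<n. dist (x (Suc k)) (x (Suc (Suc k)))) = (\<Sum>k=1..<Suc n. dist (x k) (x (Suc k)))"
    by (simp add: sum.shift_bounds_Suc_ivl lessThan_atLeast0 del: sum.op_ivl_Suc)
  also have "\<dots> \<le> 6 * \<Phi> (gap 1)" by (rule path_length_le[OF desing]) auto
  finally show "(\<Sum>k<n. dist (x (Suc k)) (x (Suc (Suc k)))) \<le> 6 * \<Phi> (gap 1)" .
qed auto

lemma iterates_convergent: "convergent x"
proof -
  have "norm (x (Suc (Suc k)) - x (Suc k)) = dist (x (Suc k)) (x (Suc (Suc k)))" for k
    by (simp only: dist_norm norm_minus_commute)
  then have "summable (\<lambda>k. norm (x (Suc (Suc k)) - x (Suc k)))"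
    using finite_length by simp
  then have "summable (\<lambda>k. x (Suc (Suc k)) - x (Suc k))"
    by (rule summable_norm_cancel)
  then have "convergent (\<lambda>n. \<Sum>k<n. x (Suc (Suc k)) - x (Suc k))"
    by (simp add: summable_iff_convergent)
  then have "convergent (\<lambda>n. x (Suc n) - x (Suc 0))"
    by (simp add: sum_lessThan_telescope[of "\<lambda>k. x (Suc k)"])
  then have "convergent (\<lambda>n. (x (Suc n) - x (Suc 0)) + x (Suc 0))"
    by (intro convergent_add convergent_const)
  then show ?thesis by (simp add: convergent_Suc_iff)
qed

lemma limit_distance_le:
  assumes \<Phi>': "desingularizes \<Phi>' \<psi> \<eta>" and lim: "x \<longlonglongrightarrow> xt" and m: "1 \<le> m"
  shows "norm (x m - xt) \<le> 6 * \<Phi>' (gap m)"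
proof -
  have "dist (x m) (x n) \<le> 6 * \<Phi>' (gap m)" if "m \<le> n" for n
  proof -
    have "dist (x m) (x n) \<le> (\<Sum>k=m..<n. dist (x k) (x (Suc k)))"
      using that
    proof (induction n rule: dec_induct)
      case (step n)
      then show ?case using dist_triangle[of "x m" "x (Suc n)" "x n"] by simp
    qed simp
    then show ?thesis using path_length_le[OF \<Phi>' m that] by linarith
  qed
  then have "\<forall>\<^sub>F n in sequentially. dist (x m) (x n) \<le> 6 * \<Phi>' (gap m)"
    using eventually_sequentially by blast
  then have "dist (x m) xt \<le> 6 * \<Phi>' (gap m)"
    by (intro tendsto_upperbound[OF tendsto_dist[OF tendsto_const lim]]) auto
  then show ?thesis by (simp add: dist_norm)
qed

lemma limit_inside: assumes "x \<longlonglongrightarrow> xt" shows "xt \<in> ball xbar r"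
proof -
  have "\<forall>\<^sub>F n in sequentially. dist xbar (x n) \<le> r / 2"
    using eventually_ge_at_top[of "1::nat"] by eventually_elim (use inside in \<open>simp add: less_imp_le\<close>)
  then have "dist xbar xt \<le> r / 2"
    by (intro tendsto_upperbound[OF tendsto_dist[OF tendsto_const assms]]) auto
  then show ?thesis using r_pos by simp
qed

lemma f_tendsto: "x \<longlonglongrightarrow> xt \<Longrightarrow> (\<lambda>k. f (x k)) \<longlonglongrightarrow> f xt"
  using differentiable_imp_continuous_within[OF differentiable] isCont_tendsto_compose by blast

lemma gradient_tendsto:
  assumes "x \<longlonglongrightarrow> xt" shows "(\<lambda>k. gradient f (x k)) \<longlonglongrightarrow> gradient f xt"
proof -
  have "continuous (at xt) (gradient f)"
    using lipschitz_on_continuous_on[OF lipschitz] limit_inside[OF assms] open_ball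
    by (simp add: continuous_on_eq_continuous_at)
  then show ?thesis using assms isCont_tendsto_compose by blast
qed

text \<open>
  If the gradient stayed away from \<open>0\<close>, then \<open>\<tau> k\<close> would be bounded by a multiple of the length of
  the \<open>k\<close>-th step, and these lengths are summable.
\<close>

lemma limit_stationary:
  assumes lim: "x \<longlonglongrightarrow> xt" and div: "\<not> summable (\<lambda>k. \<tau> (Suc k))"
  shows "gradient f xt = 0"
proof (rule ccontr)
  define e where "e = norm (gradient f xt) / 2"
  assume "gradient f xt \<noteq> 0"
  then have e: "0 < e" "e < norm (gradient f xt)" by (auto simp: e_def)
  have "\<forall>\<^sub>F k in sequentially. e < norm (gradient f (x (Suc k)))"
    using order_tendstoD(1)[OF LIMSEQ_Suc[OF tendsto_norm[OF gradient_tendsto[OF lim]]] e(2)] .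
  then have "\<forall>\<^sub>F k in sequentially. norm (\<tau> (Suc k)) \<le> 3 / (2 * e) * dist (x (Suc k)) (x (Suc (Suc k)))"
  proof eventually_elim
    case (elim k)
    have "0 \<le> \<tau> (Suc k)" using stepsize(1)[of "Suc k"] by simp
    moreover have "\<tau> (Suc k) * norm (gradient f (x (Suc k))) \<le> 3 / 2 * dist (x (Suc k)) (x (Suc (Suc k)))"
      by (rule one_step(3)[OF _ inside level]) auto
    moreover have "\<tau> (Suc k) * e \<le> \<tau> (Suc k) * norm (gradient f (x (Suc k)))"
      using elim calculation(1) by (intro mult_left_mono) auto
    ultimately show ?case using e by (simp add: field_simps)
  qed
  then have "summable (\<lambda>k. \<tau> (Suc k))"
    by (rule summable_comparison_test_ev[OF _ summable_mult[OF finite_length]])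
  with div show False by contradiction
qed

text \<open>
  A stationary point in the ball with a positive gap below \<open>\<eta>\<close> would contradict the KL inequality,
  because \<open>\<psi>\<close> is positive there.
\<close>

lemma limit_level:
  assumes lim: "x \<longlonglongrightarrow> xt" and div: "\<not> summable (\<lambda>k. \<tau> (Suc k))"
  shows "f xt = f xbar"
proof (rule ccontr)
  assume ne: "f xt \<noteq> f xbar"
  have "\<forall>\<^sub>F k in sequentially. f (x k) \<le> f (x 1)"
    using eventually_ge_at_top[of "1::nat"] by eventually_elim (use trapped in auto)
  then have "f xt \<le> f (x 1)" by (intro tendsto_upperbound[OF f_tendsto[OF lim]]) auto
  then have lt: "f xt < f xbar + \<eta>" using start_level by simp
  have gt: "f xbar < f xt" using minimal[OF limit_inside[OF lim]] ne by simp
  have "0 < \<psi> (f xt - f xbar)" using \<psi>_pos gt lt by simp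
  then show False using KL[OF limit_inside[OF lim] gt lt] limit_stationary[OF assms] by simp
qed

lemma limit_local_minimizer:
  assumes lim: "x \<longlonglongrightarrow> xt" and div: "\<not> summable (\<lambda>k. \<tau> (Suc k))"
  shows "local_minimizer f xt"
  unfolding local_minimizer_def
  using limit_inside[OF lim] limit_level[OF assms] minimal open_ball by metis

lemma limit_gap: "x \<longlonglongrightarrow> xt \<Longrightarrow> \<not> summable (\<lambda>k. \<tau> (Suc k)) \<Longrightarrow> gap \<longlonglongrightarrow> 0"
  using tendsto_diff[OF f_tendsto tendsto_const, of xt "f xbar"] limit_level by simp

lemma iterate_bound:
  assumes M: "0 < M" and q: "0 < q" "q < 1" and \<psi>: "\<forall>t>0. \<psi> t = M * t powr q"
    and lim: "x \<longlonglongrightarrow> xt" and k: "1 \<le> k"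
  shows "norm (x k - xt) \<le> 6 / (M * (1 - q)) * gap k powr (1 - q)"
  using limit_distance_le[OF desingularizes_powr[OF M q \<psi>] lim k] by simp

lemma gradient_bound:
  assumes lim: "x \<longlonglongrightarrow> xt" and div: "\<not> summable (\<lambda>k. \<tau> (Suc k))" and k: "1 \<le> k"
  shows "norm (gradient f (x k)) \<le> L * norm (x k - xt)"
  using gradient_diff_le[OF inside_ball[OF k] limit_inside[OF lim]] limit_stationary[OF lim div] by simp

text \<open>Insert the KL inequality into the decrease of \<open>f\<close>, which is quadratic in the gradient.\<close>

lemma gap_recursion:
  assumes M: "0 < M" and \<psi>: "\<forall>t>0. \<psi> t = M * t powr q"
    and b: "0 \<le> b" "b \<le> \<tau> k" and k: "1 \<le> k"
  shows "gap (Suc k) \<le> gap k - b * M\<^sup>2 / 9 * gap k powr (2 * q)"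
proof -
  have "M * gap k powr q \<le> norm (gradient f (x k))"
    using KL[OF inside_ball[OF k]] gap_positive[OF k] level[OF k] \<psi> by simp
  then have "(M * gap k powr q)\<^sup>2 \<le> (norm (gradient f (x k)))\<^sup>2"
    using M by (intro power_mono) auto
  then have "b * (M * gap k powr q)\<^sup>2 \<le> \<tau> k * (norm (gradient f (x k)))\<^sup>2"
    using b by (intro mult_mono) auto
  moreover have "(gap k powr q)\<^sup>2 = gap k powr (2 * q)"
    by (simp add: power2_eq_square flip: powr_add)
  ultimately show ?thesis
    using one_step(2)[OF k inside[OF k] level[OF k]] by (simp add: power_mult_distrib)
qed

lemma rates:
  assumes M: "0 < M" and q: "0 < q" "q < 1" and \<psi>: "\<forall>t>0. \<psi> t = M * t powr q"
    and lim: "x \<longlonglongrightarrow> xt" and div: "\<not> summable (\<lambda>k. \<tau> (Suc k))" and bdd: "bounded_away_from_0 \<tau>"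
  shows "q \<le> 1/2 \<Longrightarrow> converges_linearly_to x xt \<and>
           converges_linearly_to (\<lambda>k. gradient f (x k)) 0 \<and>
           converges_linearly_to (\<lambda>k. f (x k)) (f xbar)"
    and "q > 1/2 \<Longrightarrow>
           (\<lambda>k. norm (x k - xt)) \<in> O(\<lambda>k. real k powr (- ((1 - q) / (2 * q - 1)))) \<and>
           (\<lambda>k. norm (gradient f (x k))) \<in> O(\<lambda>k. real k powr (- ((1 - q) / (2 * q - 1)))) \<and>
           (\<lambda>k. f (x k) - f xbar) \<in> O(\<lambda>k. real k powr (- ((2 - 2 * q) / (2 * q - 1))))"
proof -
  define B where "B = 6 / (M * (1 - q))"
  have B: "0 < B" "0 < L * B" using M q L_pos by (auto simp: B_def)
  obtain b where b: "0 < b" and evb: "\<forall>\<^sub>F k in sequentially. b \<le> \<tau> k"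
    using bdd by (auto simp: bounded_away_from_0_def)
  define c where "c = b * M\<^sup>2 / 9"
  have c: "0 < c" using b M by (simp add: c_def)
  note ev1 = eventually_ge_at_top[of "1::nat"]
  have pos: "\<forall>\<^sub>F k in sequentially. 0 < gap k"
    using ev1 by eventually_elim (rule gap_positive)
  have rec: "\<forall>\<^sub>F k in sequentially. gap (Suc k) \<le> gap k - c * gap k powr (2 * q)"
    using ev1 evb by eventually_elim (use gap_recursion[OF M \<psi>] b in \<open>simp add: c_def\<close>)
  note gap0 = limit_gap[OF lim div]
  have X: "norm (x k - xt) \<le> B * gap k powr (1 - q)" if "1 \<le> k" for k
    using iterate_bound[OF M q \<psi> lim that] by (simp add: B_def)
  have evX: "\<forall>\<^sub>F k in sequentially. norm (x k - xt) \<le> B * gap k powr (1 - q)"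
    using ev1 by eventually_elim (rule X)
  have evG: "\<forall>\<^sub>F k in sequentially. norm (gradient f (x k)) \<le> L * B * gap k powr (1 - q)"
    using ev1
  proof eventually_elim
    case (elim k)
    have "L * norm (x k - xt) \<le> L * (B * gap k powr (1 - q))"
      using X[OF elim] L_pos by simp
    then show ?case using gradient_bound[OF lim div elim] by simp
  qed
  show "converges_linearly_to x xt \<and> converges_linearly_to (\<lambda>k. gradient f (x k)) 0 \<and>
        converges_linearly_to (\<lambda>k. f (x k)) (f xbar)" if q1: "q \<le> 1/2"
  proof -
    obtain A \<rho> where A: "0 < A" "0 < \<rho>" "\<rho> < 1" "\<forall>\<^sub>F k in sequentially. gap k \<le> A * \<rho> ^ k"
      using linear_decay[OF c q1 pos gap0 rec] by blast
    note transfer = converges_linearly_powr_bound[OF A pos]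
    have "\<forall>\<^sub>F k in sequentially. norm (f (x k) - f xbar) \<le> 1 * gap k powr 1"
      using pos by eventually_elim simp
    then have "converges_linearly_to (\<lambda>k. f (x k)) (f xbar)"
      by (rule transfer[rotated 2]) auto
    moreover have "converges_linearly_to x xt"
      by (rule transfer[OF B(1) _ evX]) (use q in auto)
    moreover have "converges_linearly_to (\<lambda>k. gradient f (x k)) 0"
      by (rule transfer[OF B(2), of "1 - q"]) (use q evG in auto)
    ultimately show ?thesis by blast
  qed
  assume q2: "q > 1/2"
  obtain A where A: "0 < A" "\<forall>\<^sub>F k in sequentially. gap k \<le> A * real k powr (- (1 / (2 * q - 1)))"
    using sublinear_decay[OF c q2 pos rec] by blast
  note transfer = bigo_powr_bound[OF A pos]
  have "(\<lambda>k. norm (x k - xt)) \<in> O(\<lambda>k. real k powr (- (1 / (2 * q - 1) * (1 - q))))"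
    by (rule transfer[OF B(1)]) (use q evX in auto)
  moreover have "(\<lambda>k. norm (gradient f (x k))) \<in> O(\<lambda>k. real k powr (- (1 / (2 * q - 1) * (1 - q))))"
    by (rule transfer[OF B(2)]) (use q evG in auto)
  \<comment> \<open>Since \<open>2 - 2 * q < 1\<close> and the gap is eventually below \<open>1\<close>, the claimed rate for the values is
    weaker than the rate of the gap itself.\<close>
  moreover have "gap \<in> O(\<lambda>k. real k powr (- (1 / (2 * q - 1) * (2 - 2 * q))))"
  proof (rule transfer[of 1])
    have "\<forall>\<^sub>F k in sequentially. gap k < 1" using order_tendstoD(2)[OF gap0] by simp
    with pos show "\<forall>\<^sub>F k in sequentially. norm (gap k) \<le> 1 * gap k powr (2 - 2 * q)"
    proof eventually_elim
      case (elim k)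
      then show ?case using powr_mono'[of "2 - 2 * q" 1 "gap k"] q2 by simp
    qed
  qed (use q in auto)
  ultimately show "(\<lambda>k. norm (x k - xt)) \<in> O(\<lambda>k. real k powr (- ((1 - q) / (2 * q - 1)))) \<and>
           (\<lambda>k. norm (gradient f (x k))) \<in> O(\<lambda>k. real k powr (- ((1 - q) / (2 * q - 1)))) \<and>
           (\<lambda>k. f (x k) - f xbar) \<in> O(\<lambda>k. real k powr (- ((2 - 2 * q) / (2 * q - 1))))"
    by simp
qed

end

section \<open>The algorithm as inexact gradient descent\<close>

lemma GDF_run_radius:
  assumes run: "GDF_run f G \<theta> \<mu> x\<^sub>1 \<delta>\<^sub>1 \<tau> Cs \<nu> x g i \<delta>" and k: "1 \<le> k"
  shows "0 < \<delta> k \<and> \<delta> k \<le> \<delta>\<^sub>1"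
  using k
proof (induction k rule: dec_induct)
  case base
  then show ?case using run by (simp add: GDF_run_def)
next
  case (step k)
  have \<theta>: "0 < \<theta>" "\<theta> < 1" and eq: "\<delta> (Suc k) = \<theta> ^ i k * \<delta> k"
    using run step(1) by (auto simp: GDF_run_def)
  have "\<delta> (Suc k) \<le> \<delta> k"
    unfolding eq using \<theta> step.IH by (intro mult_left_le_one_le power_le_one) auto
  moreover have "0 < \<delta> (Suc k)" using eq \<theta> step.IH by simp
  ultimately show ?case using step.IH by linarith
qed

text \<open>
  With \<open>d\<close> the accepted radius, the approximation error is at most \<open>Cs k * d\<close>, while the acceptance
  test says \<open>norm (g k) > \<mu> * Cs k * d\<close> with \<open>\<mu> > 2\<close>.
\<close>

lemma GDF_run_accuracy:
  assumes run: "GDF_run f G \<theta> \<mu> x\<^sub>1 \<delta>\<^sub>1 \<tau> Cs \<nu> x g i \<delta>" and \<delta>\<^sub>1: "\<delta>\<^sub>1 \<le> \<Delta>"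
    and approx: "\<And>d. d \<in> {0<..\<Delta>} \<Longrightarrow> norm (G (x k) d - gradient f (x k)) \<le> C * d"
    and C: "0 < C" "C \<le> Cs k" and k: "1 \<le> k"
  shows "norm (g k - gradient f (x k)) \<le> norm (g k) / 2"
proof -
  define d where "d = \<theta> ^ i k * \<delta> k"
  have \<theta>: "0 < \<theta>" "\<theta> < 1" and \<mu>: "\<mu> > 2" and \<nu>: "\<nu> k > 0"
    and g: "g k = G (x k) (min d (\<nu> k))" and next_radius: "\<delta> (Suc k) = d"
    and test: "norm (g k) > \<mu> * Cs k * d"
    using run k by (auto simp: GDF_run_def GDF_test_def d_def mult.assoc)
  have d: "0 < d" "d \<le> \<Delta>"
    using GDF_run_radius[OF run, of "Suc k"] \<delta>\<^sub>1 by (auto simp: next_radius)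
  have "norm (g k - gradient f (x k)) \<le> C * min d (\<nu> k)"
    unfolding g using d \<nu> by (intro approx) auto
  also have "\<dots> \<le> Cs k * d"
    using C d \<nu> by (intro mult_mono) auto
  also have "2 * (Cs k * d) \<le> \<mu> * (Cs k * d)"
    using \<mu> C d by (intro mult_right_mono) auto
  then have "Cs k * d \<le> norm (g k) / 2" using test by (simp add: mult.assoc)
  finally show ?thesis .
qed

text \<open>
  This provides the radius of admissible initial points. The value \<open>\<Phi> 0\<close> matters as well as the
  limit at \<open>0\<close>, because the minimum may be attained at points of the ball other than \<open>z\<close>.
\<close>

lemma desingularized_gap_small:
  fixes f :: "'a::metric_space \<Rightarrow> real" and \<Phi> :: "real \<Rightarrow> real"
  assumes cont: "isCont f z" and \<Phi>: "(\<Phi> \<longlongrightarrow> 0) (at_right 0)" "\<Phi> 0 = 0"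
    and "0 < r" "0 < \<eta>" "0 < \<epsilon>" and min: "\<And>y. y \<in> ball z r \<Longrightarrow> f z \<le> f y"
  obtains \<xi> where "0 < \<xi>" "\<xi> \<le> r"
    "\<And>y. y \<in> ball z \<xi> \<Longrightarrow> f y < f z + \<eta> \<and> \<Phi> (f y - f z) < \<epsilon>"
proof -
  have "\<forall>\<^sub>F t in at_right 0. \<Phi> t < \<epsilon>"
    using order_tendstoD(2)[OF \<Phi>(1) \<open>0 < \<epsilon>\<close>] .
  then obtain b where b: "0 < b" "\<And>t. 0 < t \<Longrightarrow> t < b \<Longrightarrow> \<Phi> t < \<epsilon>"
    by (auto simp: eventually_at_right_field)
  have "0 < min b \<eta>" using b \<open>0 < \<eta>\<close> by simp
  then obtain \<xi> where \<xi>: "0 < \<xi>" "\<And>y. dist y z < \<xi> \<Longrightarrow> dist (f y) (f z) < min b \<eta>"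
    using cont unfolding continuous_at_eps_delta by blast
  show ?thesis
  proof (rule that[of "min \<xi> r"])
    fix y assume y: "y \<in> ball z (min \<xi> r)"
    then have lt: "\<bar>f y - f z\<bar> < min b \<eta>" using \<xi>(2)[of y] by (simp add: dist_commute dist_real_def)
    have "\<Phi> (f y - f z) < \<epsilon>"
    proof (cases "f y = f z")
      case False
      then show ?thesis using min[of y] y lt by (intro b(2)) auto
    qed (use \<Phi> \<open>0 < \<epsilon>\<close> in simp)
    then show "f y < f z + \<eta> \<and> \<Phi> (f y - f z) < \<epsilon>" using lt by auto
  qed (use \<xi> \<open>0 < r\<close> in auto)
qed

section \<open>Convergence and convergence rates\<close>

theorem theorem6p1:
  fixes f :: "real ^ 'n \<Rightarrow> real"
    and xbar :: "real ^ 'n"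
    and G :: "real ^ 'n \<Rightarrow> real \<Rightarrow> real ^ 'n"
    and \<psi> :: "real \<Rightarrow> real"
    and \<Delta> \<theta> \<mu> :: real
  assumes "C1_smooth f"
    and "\<Delta> > 0"
    and "local_minimizer f xbar"
    and "KL_property_with f xbar \<psi>"
    and "lipschitz_around (gradient f) xbar"
    and "local_approximation f G"
    and "0 < \<theta>" and "\<theta> < 1"
    and "\<mu> > 2"
  shows "\<exists>\<xi>>0. \<exists>T>0. \<exists>C>0. \<forall>x\<^sub>1\<in>ball xbar \<xi>. \<forall>\<delta>\<^sub>1\<in>{0<..\<Delta>}.
    \<forall>\<tau> Cs \<nu> x g i \<delta>.
      (\<forall>k\<ge>1. \<tau> k \<in> {0..T}) \<and> (\<forall>k\<ge>1. Cs k \<ge> C) \<and> (\<forall>k\<ge>1. \<nu> k > 0) \<and>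
      GDF_run f G \<theta> \<mu> x\<^sub>1 \<delta>\<^sub>1 \<tau> Cs \<nu> x g i \<delta> \<and>
      (\<forall>k\<ge>1. gradient f (x k) \<noteq> 0) \<longrightarrow>
      convergent x \<and>
      (\<not> summable (\<lambda>k. \<tau> (Suc k)) \<longrightarrow>
        (\<exists>xt. x \<longlonglongrightarrow> xt \<and> local_minimizer f xt \<and> f xt = f xbar \<and>
          (\<forall>M q. bounded_away_from_0 \<tau> \<and> M > 0 \<and> 0 < q \<and> q < 1 \<and>
                 (\<forall>t>0. \<psi> t = M * t powr q) \<longrightarrow>
            (q \<le> 1/2 \<longrightarrow>
              converges_linearly_to x xt \<and>
              converges_linearly_to (\<lambda>k. gradient f (x k)) 0 \<and>
              converges_linearly_to (\<lambda>k. f (x k)) (f xbar)) \<and>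
            (q > 1/2 \<longrightarrow>
              (\<lambda>k. norm (x k - xt)) \<in> O(\<lambda>k. real k powr (- ((1 - q) / (2 * q - 1)))) \<and>
              (\<lambda>k. norm (gradient f (x k))) \<in> O(\<lambda>k. real k powr (- ((1 - q) / (2 * q - 1)))) \<and>
              (\<lambda>k. f (x k) - f xbar) \<in> O(\<lambda>k. real k powr (- ((2 - 2 * q) / (2 * q - 1))))))))"
proof -
  obtain U\<^sub>1 L\<^sub>0 where U\<^sub>1: "open U\<^sub>1" "xbar \<in> U\<^sub>1" "L\<^sub>0-lipschitz_on U\<^sub>1 (gradient f)"
    using assms(5) by (auto simp: lipschitz_around_def)
  obtain U\<^sub>2 where U\<^sub>2: "open U\<^sub>2" "xbar \<in> U\<^sub>2" "\<forall>y\<in>U\<^sub>2. f xbar \<le> f y"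
    using assms(3) by (auto simp: local_minimizer_def)
  obtain \<eta> U\<^sub>3 where \<eta>: "0 < \<eta>" and U\<^sub>3: "open U\<^sub>3" "xbar \<in> U\<^sub>3"
    and \<psi>: "\<forall>t\<in>{0<..<\<eta>}. \<psi> t > 0" "mono_on {0<..<\<eta>} \<psi>"
      "set_integrable lborel {0<..<\<eta>} (\<lambda>t. 1 / \<psi> t)"
    and KL: "\<forall>y\<in>U\<^sub>3. f xbar < f y \<and> f y < f xbar + \<eta> \<longrightarrow> norm (gradient f y) \<ge> \<psi> (f y - f xbar)"
    using assms(4) unfolding KL_property_with_def by blast
  have "open (U\<^sub>1 \<inter> U\<^sub>2 \<inter> U\<^sub>3)" "xbar \<in> U\<^sub>1 \<inter> U\<^sub>2 \<inter> U\<^sub>3" using U\<^sub>1 U\<^sub>2 U\<^sub>3 by auto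
  then obtain r where r: "0 < r" "ball xbar r \<subseteq> U\<^sub>1 \<inter> U\<^sub>2 \<inter> U\<^sub>3"
    using open_contains_ball by metis
  \<comment> \<open>The given Lipschitz constant may be \<open>0\<close>, and \<open>1 / (4 * L)\<close> has to be positive.\<close>
  define L where "L = L\<^sub>0 + 1"
  have "0 \<le> L\<^sub>0" using U\<^sub>1(3) lipschitz_on_nonneg by blast
  then have L: "0 < L" "L\<^sub>0 \<le> L" by (auto simp: L_def)
  have diff: "\<And>y. f differentiable (at y)" using assms(1) by (simp add: C1_smooth_def)
  interpret KL_basin f xbar r L \<eta> \<psi>
  proof
    show "L-lipschitz_on (ball xbar r) (gradient f)"
      using lipschitz_on_mono[OF U\<^sub>1(3) _ L(2), of "ball xbar r"] r by blast
  qed (use diff r L U\<^sub>2 \<psi> KL in auto)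
  obtain \<Phi> where \<Phi>: "desingularizes \<Phi> \<psi> \<eta>" "(\<Phi> \<longlongrightarrow> 0) (at_right 0)" "\<Phi> 0 = 0"
    using desingularizer_exists[OF \<eta> \<psi>] .
  obtain C where C: "0 < C"
    "\<forall>x\<in>ball xbar r. \<forall>\<delta>\<in>{0<..\<Delta>}. norm (G x \<delta> - gradient f x) \<le> C * \<delta>"
    using assms(2,6) bounded_ball unfolding local_approximation_def by metis
  have "isCont f xbar" using differentiable_imp_continuous_within[OF diff] .
  \<comment> \<open>The trapping condition reads \<open>\<xi> + 6 * \<Phi> (gap 1) < r / 2\<close>; each summand gets a share of \<open>r / 4\<close>.\<close>
  then obtain \<xi> where \<xi>: "0 < \<xi>" "\<xi> \<le> r / 4"
      "\<And>y. y \<in> ball xbar \<xi> \<Longrightarrow> f y < f xbar + \<eta> \<and> \<Phi> (f y - f xbar) < r / 24"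
    using desingularized_gap_small[of xbar f \<Phi> "r / 4" \<eta> "r / 24", OF _ \<Phi>(2,3)] \<eta> r minimal
    by auto
  show ?thesis
  proof (intro exI conjI ballI allI impI)
    show "0 < \<xi>" "0 < 1 / (4 * L)" "0 < C" using \<xi> L C by auto
    fix x\<^sub>1 \<delta>\<^sub>1 \<tau> Cs \<nu> x g i \<delta>
    assume x\<^sub>1: "x\<^sub>1 \<in> ball xbar \<xi>" and \<delta>\<^sub>1: "\<delta>\<^sub>1 \<in> {0<..\<Delta>}"
      and hyps: "(\<forall>k\<ge>1. \<tau> k \<in> {0..1 / (4 * L)}) \<and> (\<forall>k\<ge>1. Cs k \<ge> C) \<and> (\<forall>k\<ge>1. \<nu> k > 0) \<and>
        GDF_run f G \<theta> \<mu> x\<^sub>1 \<delta>\<^sub>1 \<tau> Cs \<nu> x g i \<delta> \<and> (\<forall>k\<ge>1. gradient f (x k) \<noteq> 0)"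
    then have run: "GDF_run f G \<theta> \<mu> x\<^sub>1 \<delta>\<^sub>1 \<tau> Cs \<nu> x g i \<delta>" by blast
    then have x1: "x 1 = x\<^sub>1" and upd: "\<And>k. 1 \<le> k \<Longrightarrow> x (Suc k) = x k - \<tau> k *\<^sub>R g k"
      by (auto simp: GDF_run_def)
    interpret inexact_descent f xbar r L \<eta> \<psi> \<Phi> x g \<tau>
    proof
      show "norm (g k - gradient f (x k)) \<le> norm (g k) / 2"
        if "1 \<le> k" "x k \<in> ball xbar (r / 2)" for k
        using that hyps \<delta>\<^sub>1 C r by (intro GDF_run_accuracy[OF run, of \<Delta> k C]) auto
      show "dist xbar (x 1) + 6 * \<Phi> (f (x 1) - f xbar) < r / 2"
        using \<xi>(2) \<xi>(3)[OF x\<^sub>1] x\<^sub>1 x1 by simp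
    qed (use upd hyps x1 x\<^sub>1 \<xi> r \<Phi> in auto)
    show conv: "convergent x" by (rule iterates_convergent)
    then have lim: "x \<longlonglongrightarrow> lim x" by (simp add: convergent_LIMSEQ_iff)
    assume div: "\<not> summable (\<lambda>k. \<tau> (Suc k))"
    show "x \<longlonglongrightarrow> lim x" by (rule lim)
    show "local_minimizer f (lim x)" by (rule limit_local_minimizer[OF lim div])
    show "f (lim x) = f xbar" by (rule limit_level[OF lim div])
    fix M q
    assume "bounded_away_from_0 \<tau> \<and> M > 0 \<and> 0 < q \<and> q < 1 \<and> (\<forall>t>0. \<psi> t = M * t powr q)"
    then have bdd: "bounded_away_from_0 \<tau>" and M: "0 < M" and q: "0 < q" "q < 1"
      and pow: "\<forall>t>0. \<psi> t = M * t powr q" by auto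
    note rates = rates[OF M q pow lim div bdd]
    show "converges_linearly_to x (lim x)" "converges_linearly_to (\<lambda>k. gradient f (x k)) 0"
      "converges_linearly_to (\<lambda>k. f (x k)) (f xbar)" if "q \<le> 1/2"
      using rates(1)[OF that] by auto
    show "(\<lambda>k. norm (x k - lim x)) \<in> O(\<lambda>k. real k powr (- ((1 - q) / (2 * q - 1))))"
      "(\<lambda>k. norm (gradient f (x k))) \<in> O(\<lambda>k. real k powr (- ((1 - q) / (2 * q - 1))))"
      "(\<lambda>k. f (x k) - f xbar) \<in> O(\<lambda>k. real k powr (- ((2 - 2 * q) / (2 * q - 1))))"
      if "q > 1/2"
      using rates(2)[OF that] by auto
  qed
qed

end
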